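(* For any $r>0$ and $x\in H$, the metric projection $P_{C_M(r)}:H\to C_M(r)$ satisfies: (a) $P_{C_M(r)}(x)=x$, for $x\in C_M(r)$; (b) $P_{C_M(r)}(x)=\dfrac{r}{\|x_M\|}x_M+x_{N\setminus M}$, for $x\in H\setminus C_M(r)$.
   Context: $(H,\|\cdot\|)$ is a real Hilbert space with inner product $\langle\cdot,\cdot\rangle$ and an orthonormal basis $\{e_n\}_{n\in N}$, where $N$ is a set of positive integers with cardinality greater than $1$. $M$ is a nonempty subset of $N$. For $x\in H$, $x_M=\sum_{m\in M}\langle x,e_m\rangle e_m$ and $x_{N\setminus M}=\sum_{n\in N\setminus M}\langle x,e_n\rangle e_n$. For $r>0$, $C_M(r)=\{x\in H:\|x_M\|\le r\}$. For a nonempty closed convex $C\subseteq H$, $P_C:H\to C$ is the metric projection: $P_Cx$ is the unique point of $C$ nearest to $x$. *)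

theory Defs
  imports "HOL-Analysis.Analysis"
begin

text \<open>
  A real Hilbert space is a type of sort \<open>{real_inner, banach}\<close>. The library constant
  \<open>closest_point\<close> requires in addition the class \<open>heine_borel\<close> and so excludes
  infinite dimension; this is why the metric projection is defined here.
\<close>

text \<open>An indexed orthonormal family is a Hilbert (not Hamel) basis if its linear span is dense.\<close>

definition orthonormal_basis_on :: "('i \<Rightarrow> 'a::real_inner) \<Rightarrow> 'i set \<Rightarrow> bool" where
  "orthonormal_basis_on e N \<longleftrightarrow>
     (\<forall>m\<in>N. \<forall>n\<in>N. inner (e m) (e n) = (if m = n then 1 else 0)) \<and>
     closure (span (e ` N)) = UNIV"

definition basis_part :: "('i \<Rightarrow> 'a::real_inner) \<Rightarrow> 'i set \<Rightarrow> 'a \<Rightarrow> 'a" where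
  "basis_part e M x = (\<Sum>\<^sub>\<infinity>m\<in>M. inner x (e m) *\<^sub>R e m)"

definition cylinder :: "('i \<Rightarrow> 'a::real_inner) \<Rightarrow> 'i set \<Rightarrow> real \<Rightarrow> 'a set" where
  "cylinder e M r = {x. norm (basis_part e M x) \<le> r}"

text \<open>
  The description is unspecified unless the nearest point exists and is unique; in a Hilbert space
  both hold for every nonempty closed convex \<open>C\<close>.
\<close>

definition metric_projection :: "'a::metric_space set \<Rightarrow> 'a \<Rightarrow> 'a" where
  "metric_projection C x = (THE p. p \<in> C \<and> (\<forall>q\<in>C. dist x p \<le> dist x q))"

end

theory Submission
  imports Defs
begin

text \<open>
  By Bessel's inequality the Fourier series of \<open>x\<close> over any part of the basis converges, and
  density of the span gives the orthogonal decomposition \<open>x = x\<^sub>M + x\<^sub>N\<^sub>-\<^sub>M\<close>. The candidate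
  \<open>p\<close> in case (b) lies in the cylinder, and \<open>x - p\<close> is a nonnegative multiple of \<open>x\<^sub>M\<close>;
  Cauchy-Schwarz applied to \<open>x\<^sub>M\<close> and \<open>q\<^sub>M\<close> then yields the variational inequality
  \<open>\<langle>x - p, q - p\<rangle> \<le> 0\<close> for every \<open>q\<close> in the cylinder, which characterises the nearest point.
\<close>

text \<open>Expanding the square of \<open>x - q = (x - p) - (q - p)\<close> shows that
  \<open>q\<close> loses to \<open>p\<close> by at least the square of \<open>norm (q - p)\<close>.
  This one estimate gives both minimality and uniqueness.\<close>

lemma metric_projection_eqI:
  fixes x p :: "'a::real_inner"
  assumes p: "p \<in> C" and obtuse: "\<And>q. q \<in> C \<Longrightarrow> inner (x - p) (q - p) \<le> 0"
  shows "metric_projection C x = p"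
proof -
  have key: "(norm (q - p))\<^sup>2 \<le> (dist x q)\<^sup>2 - (dist x p)\<^sup>2" if "q \<in> C" for q
    using obtuse[OF that]
    by (simp add: dist_norm power2_norm_eq_inner inner_diff_left inner_diff_right inner_commute)
  show ?thesis
    unfolding metric_projection_def
  proof (rule the_equality)
    show "p \<in> C \<and> (\<forall>q\<in>C. dist x p \<le> dist x q)"
    proof (intro conjI ballI p)
      fix q assume "q \<in> C"
      with key[of q] have "(dist x p)\<^sup>2 \<le> (dist x q)\<^sup>2"
        by (smt (verit) zero_le_power2)
      then show "dist x p \<le> dist x q"
        by (rule power2_le_imp_le) simp
    qed
  next
    fix q assume q: "q \<in> C \<and> (\<forall>q'\<in>C. dist x q \<le> dist x q')"
    then have "(dist x q)\<^sup>2 \<le> (dist x p)\<^sup>2"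
      using p by (simp add: power_mono)
    moreover have "(norm (q - p))\<^sup>2 \<le> (dist x q)\<^sup>2 - (dist x p)\<^sup>2"
      using key q by blast
    ultimately have "(norm (q - p))\<^sup>2 \<le> 0" by linarith
    then show "q = p" by simp
  qed
qed

text \<open>By Pythagoras, squared distances between nested partial sums are differences of the
  bounded monotone set function \<open>g\<close>, so the net of partial sums is Cauchy. The bound is
  on squares of norms, so absolute summability need not hold.\<close>

lemma orthogonal_summable_on:
  fixes f :: "'i \<Rightarrow> 'a::{real_inner, banach}"
  assumes orth: "\<And>i j. i \<in> A \<Longrightarrow> j \<in> A \<Longrightarrow> i \<noteq> j \<Longrightarrow> inner (f i) (f j) = 0"
    and bdd: "\<And>F. finite F \<Longrightarrow> F \<subseteq> A \<Longrightarrow> (\<Sum>i\<in>F. (norm (f i))\<^sup>2) \<le> B"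
  shows "f summable_on A"
proof -
  define g where "g F = (\<Sum>i\<in>F. (norm (f i))\<^sup>2)" for F
  define \<F> where "\<F> = {F. finite F \<and> F \<subseteq> A}"
  have bdd_g: "bdd_above (g ` \<F>)"
    using bdd unfolding bdd_above_def g_def \<F>_def by blast
  have close: "(dist (sum f F) (sum f F0))\<^sup>2 = g F - g F0" if "finite F" "F \<subseteq> A" "F0 \<subseteq> F" for F F0
  proof -
    have "sum f F - sum f F0 = sum f (F - F0)"
      using that by (simp add: sum_diff)
    then have "(dist (sum f F) (sum f F0))\<^sup>2 = (norm (sum f (F - F0)))\<^sup>2"
      by (simp add: dist_norm)
    also have "\<dots> = g (F - F0)"
      unfolding g_def
    proof (rule norm_sum_Pythagorean)
      show "finite (F - F0)" using that by simp
      show "pairwise (\<lambda>i j. orthogonal (f i) (f j)) (F - F0)"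
        using that orth unfolding pairwise_def orthogonal_def by blast
    qed
    also have "\<dots> = g F - g F0"
      using that by (simp add: g_def sum_diff)
    finally show ?thesis .
  qed
  have "\<exists>P. eventually P (finite_subsets_at_top A) \<and>
             (\<forall>F F'. P F \<and> P F' \<longrightarrow> dist (sum f F) (sum f F') < \<epsilon>)" if "\<epsilon> > 0" for \<epsilon>
  proof -
    \<comment> \<open>The gap is squared because \<open>close\<close> controls squared distances:
      every finite superset of \<open>F0\<close> in \<open>A\<close> then has its sum within
      \<open>\<epsilon>/2\<close> of that over \<open>F0\<close>.\<close>
    have "Sup (g ` \<F>) - (\<epsilon>/2)\<^sup>2 < Sup (g ` \<F>)" using that by simp
    moreover have "g ` \<F> \<noteq> {}" by (auto simp: \<F>_def)
    ultimately obtain F0 where F0: "F0 \<in> \<F>" "Sup (g ` \<F>) - (\<epsilon>/2)\<^sup>2 < g F0"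
      using less_cSupD[of "g ` \<F>"] by blast
    define P where "P F \<longleftrightarrow> finite F \<and> F0 \<subseteq> F \<and> F \<subseteq> A" for F
    have "eventually P (finite_subsets_at_top A)"
      using F0 unfolding eventually_finite_subsets_at_top P_def \<F>_def by blast
    moreover have near: "dist (sum f F) (sum f F0) < \<epsilon>/2" if "P F" for F
    proof -
      have "g F \<le> Sup (g ` \<F>)"
        using that bdd_g by (intro cSUP_upper) (auto simp: P_def \<F>_def)
      with F0 close[of F F0] that have "(dist (sum f F) (sum f F0))\<^sup>2 < (\<epsilon>/2)\<^sup>2"
        by (simp add: P_def)
      then show ?thesis
        by (rule power2_less_imp_less) (use \<open>\<epsilon> > 0\<close> in simp)
    qed
    have "dist (sum f F) (sum f F') < \<epsilon>" if "P F" "P F'" for F F'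
      using dist_triangle_half_l[OF near near] that by blast
    ultimately show ?thesis by blast
  qed
  then have "cauchy_filter (filtermap (sum f) (finite_subsets_at_top A))"
    by (simp add: cauchy_filter_metric_filtermap)
  moreover have "complete (UNIV::'a set)"
    by (meson Cauchy_convergent UNIV_I complete_def convergent_def)
  \<comment> \<open>Partial sums are indexed by finite sets, so sequential completeness is used in
    its equivalent form for Cauchy filters.\<close>
  ultimately obtain L where "(sum f \<longlongrightarrow> L) (finite_subsets_at_top A)"
    using complete_uniform[where S=UNIV] by (force simp add: filterlim_def)
  then show ?thesis
    using summable_on_def has_sum_def by blast
qed

context
  fixes e :: "'i \<Rightarrow> 'a::{real_inner, banach}" and N :: "'i set"
  assumes basis: "orthonormal_basis_on e N"
begin

lemma inner_basis:
  "m \<in> N \<Longrightarrow> n \<in> N \<Longrightarrow> inner (e m) (e n) = (if m = n then 1 else 0)"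
  using basis by (simp add: orthonormal_basis_on_def)

text \<open>With \<open>?s\<close> the orthogonal projection of \<open>x\<close> onto the span of
  finitely many basis vectors, the claim is that the squared norm of \<open>x - ?s\<close> is
  nonnegative.\<close>

lemma Bessel_inequality:
  assumes "finite F" "F \<subseteq> N"
  shows "(\<Sum>i\<in>F. (inner x (e i))\<^sup>2) \<le> (norm x)\<^sup>2"
proof -
  let ?s = "\<Sum>i\<in>F. inner x (e i) *\<^sub>R e i"
  have xs: "inner x ?s = (\<Sum>i\<in>F. (inner x (e i))\<^sup>2)"
    by (simp add: inner_sum_right power2_eq_square)
  have "inner (e i) ?s = inner x (e i)" if "i \<in> F" for i
  proof -
    have "inner (e i) ?s = (\<Sum>j\<in>F. if i = j then inner x (e j) else 0)"
      unfolding inner_sum_right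
      by (rule sum.cong) (use that assms in \<open>auto simp: inner_basis subset_iff\<close>)
    then show ?thesis using that assms by simp
  qed
  then have ss: "inner ?s ?s = (\<Sum>i\<in>F. (inner x (e i))\<^sup>2)"
    by (simp add: inner_sum_left power2_eq_square)
  have "0 \<le> inner (x - ?s) (x - ?s)" by simp
  also have "\<dots> = (norm x)\<^sup>2 - (\<Sum>i\<in>F. (inner x (e i))\<^sup>2)"
    using xs ss by (simp add: inner_diff_left inner_diff_right inner_commute power2_norm_eq_inner)
  finally show ?thesis by simp
qed

lemma basis_expansion_summable:
  assumes "A \<subseteq> N"
  shows "(\<lambda>i. inner x (e i) *\<^sub>R e i) summable_on A"
proof (rule orthogonal_summable_on)
  show "inner (inner x (e i) *\<^sub>R e i) (inner x (e j) *\<^sub>R e j) = 0"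
    if "i \<in> A" "j \<in> A" "i \<noteq> j" for i j
    using that assms by (simp add: inner_basis subset_iff)
next
  fix F assume F: "finite F" "F \<subseteq> A"
  have "norm (e i) = 1" if "i \<in> F" for i
    using that F assms by (simp add: norm_eq_1 inner_basis subset_iff)
  then have "(\<Sum>i\<in>F. (norm (inner x (e i) *\<^sub>R e i))\<^sup>2) = (\<Sum>i\<in>F. (inner x (e i))\<^sup>2)"
    by simp
  also have "\<dots> \<le> (norm x)\<^sup>2"
    using F assms by (intro Bessel_inequality) auto
  finally show "(\<Sum>i\<in>F. (norm (inner x (e i) *\<^sub>R e i))\<^sup>2) \<le> (norm x)\<^sup>2" .
qed

text \<open>Continuity of the inner product moves it inside the series. Uniqueness of sums then
  evaluates inner products with \<open>basis_part\<close>.\<close>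

lemma has_sum_inner_basis_part:
  assumes "A \<subseteq> N"
  shows "((\<lambda>i. inner x (e i) * inner y (e i)) has_sum inner y (basis_part e A x)) A"
  using has_sum_bounded_linear[OF bounded_linear_inner_right
      has_sum_infsum[OF basis_expansion_summable[OF assms]], of y x]
  by (simp add: basis_part_def)

lemma inner_basis_part_basis:
  assumes "A \<subseteq> N" "n \<in> N"
  shows "inner (basis_part e A x) (e n) = (if n \<in> A then inner x (e n) else 0)"
proof -
  have "((\<lambda>i. inner x (e i) * inner (e n) (e i)) has_sum (if n \<in> A then inner x (e n) else 0)) A"
    \<comment> \<open>Only the term \<open>i = n\<close> can be nonzero;
      \<open>A \<inter> {n}\<close> is empty when \<open>n\<close> lies outside \<open>A\<close>,
      which covers both cases at once.\<close>
    by (rule has_sum_finite_neutralI[where B = "A \<inter> {n}"])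
      (use assms in \<open>auto simp: inner_basis subset_iff\<close>)
  then have "inner (e n) (basis_part e A x) = (if n \<in> A then inner x (e n) else 0)"
    by (rule has_sum_unique[OF has_sum_inner_basis_part[OF assms(1)]])
  then show ?thesis by (simp only: inner_commute)
qed

text \<open>The vectors orthogonal to \<open>y\<close> form a closed subspace. It contains the
  basis, hence the closure of its span, hence \<open>y\<close> itself.\<close>

lemma orthogonal_to_basis_imp_zero:
  assumes "\<And>n. n \<in> N \<Longrightarrow> inner y (e n) = 0"
  shows "y = 0"
proof -
  have "span (e ` N) \<subseteq> {z. inner y z = 0}"
    using assms by (intro span_minimal subspace_hyperplane) auto
  then have "closure (span (e ` N)) \<subseteq> {z. inner y z = 0}"
    by (intro closure_minimal closed_hyperplane)
  then have "inner y y = 0"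
    using basis unfolding orthonormal_basis_on_def by blast
  then show ?thesis by simp
qed

lemma basis_part_decomposition:
  assumes "M \<subseteq> N"
  shows "basis_part e M x + basis_part e (N - M) x = x"
proof -
  have "basis_part e M x + basis_part e (N - M) x - x = 0"
    by (rule orthogonal_to_basis_imp_zero)
      (use assms in \<open>auto simp: inner_diff_left inner_add_left inner_basis_part_basis\<close>)
  then show ?thesis by simp
qed

lemma inner_basis_parts_disjoint:
  assumes "A \<subseteq> N" "B \<subseteq> N" "A \<inter> B = {}"
  shows "inner (basis_part e A x) (basis_part e B y) = 0"
proof -
  have "((\<lambda>i. inner y (e i) * inner (basis_part e A x) (e i)) has_sum 0) B"
  proof (rule has_sum_0)
    fix i assume "i \<in> B"
    then have "i \<in> N" "i \<notin> A" using assms by auto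
    then show "inner y (e i) * inner (basis_part e A x) (e i) = 0"
      using assms(1) by (simp add: inner_basis_part_basis)
  qed
  then show ?thesis
    by (rule has_sum_unique[OF has_sum_inner_basis_part[OF assms(2)]])
qed

text \<open>The part of \<open>y\<close> over \<open>N - M\<close> is orthogonal to the
  \<open>M\<close>-part of \<open>x\<close>. This replaces a point of the cylinder by its
  \<open>M\<close>-part, the only part whose norm is bounded there.\<close>

lemma inner_basis_part_idem:
  assumes "M \<subseteq> N"
  shows "inner (basis_part e M x) y = inner (basis_part e M x) (basis_part e M y)"
proof -
  have "inner (basis_part e M x) (basis_part e (N - M) y) = 0"
    by (rule inner_basis_parts_disjoint) (use assms in auto)
  then show ?thesis
    using inner_add_right[of "basis_part e M x" "basis_part e M y" "basis_part e (N - M) y"]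
    unfolding basis_part_decomposition[OF assms] by simp
qed

lemma basis_part_combination:
  assumes "M \<subseteq> N"
  shows "basis_part e M (c *\<^sub>R basis_part e M x + basis_part e (N - M) x) = c *\<^sub>R basis_part e M x"
proof -
  let ?y = "c *\<^sub>R basis_part e M x + basis_part e (N - M) x"
  have "basis_part e M ?y = (\<Sum>\<^sub>\<infinity>m\<in>M. c *\<^sub>R (inner x (e m) *\<^sub>R e m))"
    unfolding basis_part_def[of e M ?y]
  proof (rule infsum_cong)
    fix m assume m: "m \<in> M"
    with assms have "m \<in> N" by auto
    with m have "inner ?y (e m) = c * inner x (e m)"
      using assms by (simp add: inner_add_left inner_basis_part_basis)
    then show "inner ?y (e m) *\<^sub>R e m = c *\<^sub>R (inner x (e m) *\<^sub>R e m)" by simp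
  qed
  then show ?thesis
    by (simp only: infsum_scaleR_right basis_part_def)
qed

lemma metric_projection_cylinder_outside:
  assumes "M \<subseteq> N" "0 \<le> r" "x \<notin> cylinder e M r"
  shows "metric_projection (cylinder e M r) x =
           (r / norm (basis_part e M x)) *\<^sub>R basis_part e M x + basis_part e (N - M) x"
proof (rule metric_projection_eqI)
  let ?u = "basis_part e M x"
  let ?p = "(r / norm ?u) *\<^sub>R ?u + basis_part e (N - M) x"
  \<comment> \<open>These bounds make the division by \<open>norm ?u\<close> genuine and the factor
    \<open>1 - r / norm ?u\<close> positive.\<close>
  have u: "r < norm ?u" "0 < norm ?u"
    using assms by (auto simp: cylinder_def)
  have part_p: "basis_part e M ?p = (r / norm ?u) *\<^sub>R ?u"
    by (rule basis_part_combination) fact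
  show "?p \<in> cylinder e M r"
    using u assms(2) by (simp add: cylinder_def part_p)
  fix q assume q: "q \<in> cylinder e M r"
  have "x - ?p = (?u + basis_part e (N - M) x) - ?p"
    by (simp only: basis_part_decomposition[OF assms(1)])
  also have "\<dots> = (1 - r / norm ?u) *\<^sub>R ?u"
    by (simp add: scaleR_left_diff_distrib)
  finally have "x - ?p = (1 - r / norm ?u) *\<^sub>R ?u" .
  moreover have "inner ?u (q - ?p) \<le> 0"
  proof -
    have "inner ?u q = inner ?u (basis_part e M q)"
      by (rule inner_basis_part_idem) fact
    also have "\<dots> \<le> norm ?u * norm (basis_part e M q)"
      by (rule norm_cauchy_schwarz)
    also have "\<dots> \<le> norm ?u * r"
      using q by (simp add: cylinder_def mult_left_mono)
    \<comment> \<open>The scaling in \<open>?p\<close> makes its \<open>M\<close>-part a multiple of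
      \<open>?u\<close> of norm exactly \<open>r\<close>, so Cauchy-Schwarz is attained at
      \<open>?p\<close>.\<close>
    also have "\<dots> = inner ?u ?p"
      using u unfolding inner_basis_part_idem[OF assms(1), of x ?p] part_p
      by (simp add: power2_norm_eq_inner[symmetric] power2_eq_square)
    finally show ?thesis by (simp add: inner_diff_right)
  qed
  ultimately show "inner (x - ?p) (q - ?p) \<le> 0"
    using u by (simp add: mult_nonneg_nonpos)
qed

end

theorem theorem6p5:
  fixes e :: "nat \<Rightarrow> 'a::{real_inner, banach}"
    and N M :: "nat set"
    and r :: real
    and x :: 'a
  assumes "\<forall>n\<in>N. 0 < n"
    and "infinite N \<or> 1 < card N"
    and "orthonormal_basis_on e N"
    and "M \<subseteq> N"
    and "M \<noteq> {}"
    and "0 < r"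
  shows "(x \<in> cylinder e M r \<longrightarrow> metric_projection (cylinder e M r) x = x) \<and>
         (x \<notin> cylinder e M r \<longrightarrow>
            metric_projection (cylinder e M r) x =
              (r / norm (basis_part e M x)) *\<^sub>R basis_part e M x + basis_part e (N - M) x)"
  \<comment> \<open>For \<open>x\<close> inside the cylinder, \<open>p = x\<close> turns the
    variational inequality into \<open>0 \<le> 0\<close>.\<close>
  using metric_projection_cylinder_outside[OF assms(3,4)] assms(6)
  by (simp add: metric_projection_eqI)

end
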